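(* Let $\mathbf{A}\in\mathbb{R}^{N\times N}$ be diagonalizable with eigendecomposition $\mathbf{A}=\mathbf{V}\boldsymbol{\Lambda}\mathbf{V}^{-1}$, let $\mathbf{A}_\phi=\mathbf{V}\boldsymbol{\Lambda}_\phi\mathbf{V}^{-1}$ be an associated graph shift operator, let $\mathbf{x},\mathbf{y}\in\mathbb{C}^N$ and $1\le L\le N$. Then $\mathbf{h}=[h_0,\dots,h_{L-1}]^T\in\mathbb{C}^L$ is a solution of the optimal filtering problem $$\min_{\mathbf{h}\in\mathbb{C}^L}\Big\|\sum_{k=0}^{L-1}h_k\mathbf{A}_\phi^k\mathbf{y}-\mathbf{x}\Big\|_2^2$$ if and only if it satisfies the graph Wiener--Hopf equation $$\mathbf{R}^G_{\mathbf{yy}}\mathbf{h}=\mathbf{r}^G_{\mathbf{xy}},$$ where $\mathbf{R}^G_{\mathbf{yy}}$ is the $L\times L$ matrix with entries $\mathbf{R}^G_{\mathbf{yy}}(i,j)=R^G_{\mathbf{yy}}(i-1,j-1)$ and $\mathbf{r}^G_{\mathbf{xy}}\in\mathbb{C}^L$ has entries $\mathbf{r}^G_{\mathbf{xy}}(i)=r^G_{\mathbf{xy}}(i-1)$, $1\le i,j\le L$.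
   Context: A graph on $N$ nodes is given by a real weighted adjacency matrix $\mathbf{A}\in\mathbb{R}^{N\times N}$ (directed or undirected), assumed diagonalizable (over $\mathbb{C}$), $\mathbf{A}=\mathbf{V}\boldsymbol{\Lambda}\mathbf{V}^{-1}$ with $\mathbf{V}\in\mathbb{C}^{N\times N}$ invertible and $\boldsymbol{\Lambda}$ diagonal. Graph shift operator: $\mathbf{A}_\phi=\mathbf{V}\boldsymbol{\Lambda}_\phi\mathbf{V}^{-1}$ with $\boldsymbol{\Lambda}_\phi=\mathrm{diag}(e^{\mathrm{i}\phi_1},\dots,e^{\mathrm{i}\phi_N})$, where $\mathrm{i}=\sqrt{-1}$ and $\phi_1,\dots,\phi_N\in[0,2\pi]$ are arbitrary phases with $\phi_k\ne\phi_l$ for $k\neq l$. $(\cdot)^H$ denotes conjugate transpose. Graph autocorrelation of $\mathbf{y}$ at lags $l,m\ge0$: $R^G_{\mathbf{yy}}(l,m)=\mathbf{y}^H(\mathbf{A}_\phi^l)^H\mathbf{A}_\phi^m\mathbf{y}$. Graph cross-correlation of $\mathbf{x}$ and $\mathbf{y}$ at lag $l\ge 0$: $r^G_{\mathbf{xy}}(l)=\mathbf{y}^H(\mathbf{A}_\phi^l)^H\mathbf{x}$. *)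

theory Defs
  imports "Jordan_Normal_Form.Schur_Decomposition" "HOL-Analysis.L2_Norm"
begin

text \<open>
  Indices are 0-based, so the entry at position (i, j), 1 \<le> i, j \<le> L, of the autocorrelation
  matrix is the entry (i - 1, j - 1) here. The product of a row vector \<open>v\<^sup>H\<close> with a
  column vector \<open>w\<close> is written \<open>conjugate v \<bullet> w\<close>; the scalar product
  itself does not conjugate. The conjugate transpose of a matrix is \<^const>\<open>mat_adjoint\<close>.
\<close>

text \<open>\<open>W\<close> stands for the inverse of \<open>V\<close>. The original graph eigenvalues
  do not enter.\<close>

definition graph_shift :: "nat \<Rightarrow> complex mat \<Rightarrow> complex mat \<Rightarrow> (nat \<Rightarrow> real) \<Rightarrow> complex mat" where
  "graph_shift N V W \<phi> = V * mat_diag N (\<lambda>k. exp (\<i> * complex_of_real (\<phi> k))) * W"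

definition graph_autocorr :: "complex mat \<Rightarrow> complex vec \<Rightarrow> nat \<Rightarrow> nat \<Rightarrow> complex" where
  "graph_autocorr S y l m = conjugate y \<bullet> (mat_adjoint (S ^\<^sub>m l) *\<^sub>v (S ^\<^sub>m m *\<^sub>v y))"

definition graph_crosscorr :: "complex mat \<Rightarrow> complex vec \<Rightarrow> complex vec \<Rightarrow> nat \<Rightarrow> complex" where
  "graph_crosscorr S x y l = conjugate y \<bullet> (mat_adjoint (S ^\<^sub>m l) *\<^sub>v x)"

definition autocorr_mat :: "nat \<Rightarrow> complex mat \<Rightarrow> complex vec \<Rightarrow> complex mat" where
  "autocorr_mat L S y = mat L L (\<lambda>(i, j). graph_autocorr S y i j)"

definition crosscorr_vec :: "nat \<Rightarrow> complex mat \<Rightarrow> complex vec \<Rightarrow> complex vec \<Rightarrow> complex vec" where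
  "crosscorr_vec L S x y = vec L (\<lambda>i. graph_crosscorr S x y i)"

definition graph_filter :: "complex mat \<Rightarrow> complex vec \<Rightarrow> complex vec \<Rightarrow> complex vec" where
  "graph_filter S h y =
     finsum_vec TYPE(complex) (dim_row S) (\<lambda>k. h $ k \<cdot>\<^sub>v (S ^\<^sub>m k *\<^sub>v y)) {..<dim_vec h}"

definition norm2_vec :: "complex vec \<Rightarrow> real" where
  "norm2_vec v = L2_set (\<lambda>i. cmod (v $ i)) {..<dim_vec v}"

definition filtering_solution ::
  "nat \<Rightarrow> complex mat \<Rightarrow> complex vec \<Rightarrow> complex vec \<Rightarrow> complex vec \<Rightarrow> bool" where
  "filtering_solution L S x y h \<longleftrightarrow>
     is_arg_min (\<lambda>g. (norm2_vec (graph_filter S g y - x))\<^sup>2) (\<lambda>g. g \<in> carrier_vec L) h"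

end

(* The filter output is U h, where the columns of U are the shifted signals S^k y, so the problem is an
   ordinary complex least squares problem and the Wiener-Hopf equation is its normal equation
   U^H U h = U^H x. With e = U h - x and g = U^H e one has
   |U (h + d) - x|^2 = |e|^2 + 2 Re <d, g> + |U d|^2, which gives sufficiency at once;
   taking d = - t g with small t > 0 gives necessity. *)

theory Submission
  imports Defs
begin

lemma mat_adjoint_carrier:
  "A \<in> carrier_mat n m \<Longrightarrow> mat_adjoint A \<in> carrier_mat m n"
  unfolding mat_adjoint_def by auto

text \<open>Both sides are the same finite double sum with the order of summation exchanged. This is
  the only way an adjoint is moved across a scalar product below, both for U and for the powers of
  S.\<close>

lemma conjugate_scalar_prod_adjoint:
  fixes A :: "complex mat"
  assumes A: "A \<in> carrier_mat n m" and v: "v \<in> carrier_vec m" and w: "w \<in> carrier_vec n"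
  shows "conjugate v \<bullet> (mat_adjoint A *\<^sub>v w) = conjugate (A *\<^sub>v v) \<bullet> w"
proof -
  have "conjugate v \<bullet> (mat_adjoint A *\<^sub>v w)
    = (\<Sum>i<m. \<Sum>j<n. cnj (v $ i) * (cnj (A $$ (j, i)) * w $ j))"
    using A v w unfolding mat_adjoint_def
    by (auto simp: scalar_prod_def mat_of_rows_def sum_distrib_left lessThan_atLeast0 intro!: sum.cong)
  also have "\<dots> = (\<Sum>j<n. \<Sum>i<m. cnj (v $ i) * (cnj (A $$ (j, i)) * w $ j))"
    by (rule sum.swap)
  also have "\<dots> = conjugate (A *\<^sub>v v) \<bullet> w"
    using A v w
    by (auto simp: scalar_prod_def sum_distrib_left sum_distrib_right lessThan_atLeast0 mult_ac
        intro!: sum.cong)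
  finally show ?thesis .
qed

lemma norm2_vec_sq: "(norm2_vec v)\<^sup>2 = (\<Sum>i<dim_vec v. (cmod (v $ i))\<^sup>2)"
  unfolding norm2_vec_def L2_set_def by (simp add: sum_nonneg)

lemma conjugate_scalar_prod_self:
  "conjugate v \<bullet> v = complex_of_real ((norm2_vec v)\<^sup>2)"
  unfolding norm2_vec_sq scalar_prod_def
  by (auto simp: lessThan_atLeast0 complex_norm_square mult.commute simp del: of_real_power
      intro!: sum.cong)

lemma norm2_vec_sq_eq_0:
  assumes "v \<in> carrier_vec n" "(norm2_vec v)\<^sup>2 = 0"
  shows "v = 0\<^sub>v n"
  using assms by (auto simp: norm2_vec_sq sum_nonneg_eq_0_iff)

text \<open>Summing the scalar identity |a + b|^2 = |a|^2 + 2 Re (cnj b * a) + |b|^2 over the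
  entries. Conjugating the increment \<open>w\<close> leaves the cross term in the form to which the
  adjoint rule applies.\<close>

lemma norm2_vec_sq_add:
  assumes u: "u \<in> carrier_vec n" and w: "w \<in> carrier_vec n"
  shows "(norm2_vec (u + w))\<^sup>2
    = (norm2_vec u)\<^sup>2 + 2 * Re (conjugate w \<bullet> u) + (norm2_vec w)\<^sup>2"
proof -
  have "(cmod (a + b))\<^sup>2 = (cmod a)\<^sup>2 + 2 * Re (cnj b * a) + (cmod b)\<^sup>2" for a b
    by (simp only: cmod_power2) (simp add: power2_eq_square algebra_simps)
  then show ?thesis
    using u w unfolding norm2_vec_sq scalar_prod_def
    by (simp add: sum.distrib sum_distrib_left lessThan_atLeast0)
qed

lemma norm2_vec_sq_smult:
  "(norm2_vec (complex_of_real t \<cdot>\<^sub>v v))\<^sup>2 = t\<^sup>2 * (norm2_vec v)\<^sup>2"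
  by (simp add: norm2_vec_sq norm_mult power_mult_distrib sum_distrib_left)

text \<open>The exact quadratic expansion around \<open>h\<close> takes the place of complex
  differentiation. If U is rank deficient, both sides describe the same affine set of
  minimizers.\<close>

lemma least_squares_iff_normal_equation:
  fixes U :: "complex mat"
  assumes U: "U \<in> carrier_mat n m" and x: "x \<in> carrier_vec n" and h: "h \<in> carrier_vec m"
  shows "is_arg_min (\<lambda>g. (norm2_vec (U *\<^sub>v g - x))\<^sup>2) (\<lambda>g. g \<in> carrier_vec m) h
    \<longleftrightarrow> mat_adjoint U *\<^sub>v (U *\<^sub>v h) = mat_adjoint U *\<^sub>v x"
proof -
  define e where "e = U *\<^sub>v h - x"
  define g where "g = mat_adjoint U *\<^sub>v e"
  have Uc: "U *\<^sub>v d \<in> carrier_vec n" for d using U by (intro carrier_vecI) simp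
  have e: "e \<in> carrier_vec n" using Uc x by (simp add: e_def)
  note Ua = mat_adjoint_carrier[OF U]
  have g: "g \<in> carrier_vec m" using Ua e by (simp add: g_def)
  \<comment> \<open>The residual moves by U d, and the adjoint carries U from \<open>d\<close> to
    \<open>e\<close> in the cross term, which produces \<open>g\<close>.\<close>
  have shift: "(norm2_vec (U *\<^sub>v (h + d) - x))\<^sup>2
      = (norm2_vec e)\<^sup>2 + 2 * Re (conjugate d \<bullet> g) + (norm2_vec (U *\<^sub>v d))\<^sup>2"
    if d: "d \<in> carrier_vec m" for d
  proof -
    have "U *\<^sub>v (h + d) - x = e + U *\<^sub>v d"
      unfolding e_def mult_add_distrib_mat_vec[OF U h d]
      using U x by (intro eq_vecI) auto
    then show ?thesis
      using norm2_vec_sq_add[OF e Uc] conjugate_scalar_prod_adjoint[OF U d e] by (simp add: g_def)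
  qed
  have "g = mat_adjoint U *\<^sub>v (U *\<^sub>v h) - mat_adjoint U *\<^sub>v x"
    unfolding g_def e_def using Ua Uc x by (rule mult_minus_distrib_mat_vec)
  then have g0: "mat_adjoint U *\<^sub>v (U *\<^sub>v h) = mat_adjoint U *\<^sub>v x \<longleftrightarrow> g = 0\<^sub>v m"
    using Ua by (auto simp: vec_eq_iff)
  show ?thesis unfolding g0
  proof
    assume g_zero: "g = 0\<^sub>v m"
    have "(norm2_vec e)\<^sup>2 \<le> (norm2_vec (U *\<^sub>v f - x))\<^sup>2" if f: "f \<in> carrier_vec m" for f
    proof -
      \<comment> \<open>Every competitor is \<open>h\<close> plus an increment. With
        \<open>g\<close> zero the cross term vanishes and only |U d|^2 is added.\<close>
      have d: "f - h \<in> carrier_vec m" and "f = h + (f - h)" using f h by auto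
      then show ?thesis using shift[OF d] g_zero by simp
    qed
    then show "is_arg_min (\<lambda>g. (norm2_vec (U *\<^sub>v g - x))\<^sup>2) (\<lambda>g. g \<in> carrier_vec m) h"
      using h by (simp add: is_arg_min_linorder e_def)
  next
    assume min: "is_arg_min (\<lambda>g. (norm2_vec (U *\<^sub>v g - x))\<^sup>2) (\<lambda>g. g \<in> carrier_vec m) h"
    define a where "a = (norm2_vec g)\<^sup>2"
    define b where "b = (norm2_vec (U *\<^sub>v g))\<^sup>2"
    \<comment> \<open>A step of length t along - g changes the objective by - 2 t a + t^2 b. The 1
      keeps the denominator positive when U g = 0. Since a = t (b + 1), the change equals - t^2 (b +
      2), a strict decrease unless t = 0.\<close>
    define t where "t = a / (b + 1)"
    have ab: "0 \<le> a" "0 \<le> b" by (simp_all add: a_def b_def)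
    define d where "d = complex_of_real (- t) \<cdot>\<^sub>v g"
    have d: "d \<in> carrier_vec m" using g by (simp add: d_def)
    have "(norm2_vec (U *\<^sub>v d))\<^sup>2 = t\<^sup>2 * b"
      unfolding d_def mult_mat_vec[OF U g] norm2_vec_sq_smult by (simp add: b_def)
    moreover have "Re (conjugate d \<bullet> g) = - t * a"
      using g unfolding d_def by (simp add: conjugate_smult_vec conjugate_scalar_prod_self a_def
          flip: of_real_power)
    moreover have "(norm2_vec e)\<^sup>2 \<le> (norm2_vec (U *\<^sub>v (h + d) - x))\<^sup>2"
      using min h d by (simp add: is_arg_min_linorder e_def)
    ultimately have "2 * t * a \<le> t\<^sup>2 * b" using shift[OF d] by simp
    moreover have "a = t * (b + 1)" using ab by (simp add: t_def)
    ultimately have "t\<^sup>2 * (b + 2) \<le> 0" by (simp add: power2_eq_square algebra_simps)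
    then have "t = 0" using ab by (simp add: mult_le_0_iff)
    then have "a = 0" using \<open>a = t * (b + 1)\<close> by simp
    then show "g = 0\<^sub>v m" using norm2_vec_sq_eq_0[OF g] by (simp add: a_def)
  qed
qed

text \<open>The matrix U of the least squares problem; its range is the set of outputs of filters
  with L coefficients.\<close>

definition krylov_mat :: "nat \<Rightarrow> complex mat \<Rightarrow> complex vec \<Rightarrow> complex mat" where
  "krylov_mat L S y = mat_of_cols (dim_row S) (map (\<lambda>k. S ^\<^sub>m k *\<^sub>v y) [0..<L])"

lemma krylov_mat_carrier:
  "S \<in> carrier_mat N N \<Longrightarrow> krylov_mat L S y \<in> carrier_mat N L"
  unfolding krylov_mat_def by auto

lemma col_krylov_mat:
  assumes "S \<in> carrier_mat N N" "k < L"
  shows "col (krylov_mat L S y) k = S ^\<^sub>m k *\<^sub>v y"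
  using assms pow_carrier_mat[OF assms(1), of k] unfolding krylov_mat_def
  by (subst col_mat_of_cols) (auto intro: carrier_vecI)

lemma graph_filter_eq_krylov_mat:
  assumes S: "S \<in> carrier_mat N N" and h: "h \<in> carrier_vec L"
  shows "graph_filter S h y = krylov_mat L S y *\<^sub>v h"
proof (rule eq_vecI)
  \<comment> \<open>\<open>finsum_vec\<close> is a sum in a monoid with carrier, so its dimension
    and entries are accessible only once all summands are known to lie there.\<close>
  have c: "(\<lambda>k. h $ k \<cdot>\<^sub>v (S ^\<^sub>m k *\<^sub>v y)) \<in> {..<L} \<rightarrow> carrier_vec N"
    using S pow_carrier_mat[OF S] by (auto intro!: carrier_vecI)
  show "dim_vec (graph_filter S h y) = dim_vec (krylov_mat L S y *\<^sub>v h)"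
    using S h finsum_vec_closed[OF c] krylov_mat_carrier[OF S, of L y]
    by (simp add: graph_filter_def)
  fix i assume "i < dim_vec (krylov_mat L S y *\<^sub>v h)"
  then have i: "i < N" using krylov_mat_carrier[OF S, of L y] by simp
  have "graph_filter S h y $ i = (\<Sum>k<L. h $ k * (S ^\<^sub>m k *\<^sub>v y) $ i)"
    using S h i index_finsum_vec[OF _ i c] by (simp add: graph_filter_def del: index_mult_mat_vec)
  also have "\<dots> = (\<Sum>k<L. krylov_mat L S y $$ (i, k) * h $ k)"
    using S i by (intro sum.cong) (simp_all add: krylov_mat_def mat_of_cols_index mult.commute
        del: index_mult_mat_vec)
  also have "\<dots> = (krylov_mat L S y *\<^sub>v h) $ i"
    using krylov_mat_carrier[OF S, of L y] h i by (simp add: scalar_prod_def lessThan_atLeast0)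
  finally show "graph_filter S h y $ i = (krylov_mat L S y *\<^sub>v h) $ i" .
qed

lemma row_mat_adjoint:
  "i < dim_col A \<Longrightarrow> row (mat_adjoint A) i = conjugate (col A i)"
  unfolding mat_adjoint_def by simp

text \<open>Row i of U^H is the conjugate of S^i y, and y^H (S^i)^H x = (S^i y)^H x.\<close>

lemma crosscorr_vec_eq_krylov_mat:
  assumes S: "S \<in> carrier_mat N N" and x: "x \<in> carrier_vec N" and y: "y \<in> carrier_vec N"
  shows "crosscorr_vec L S x y = mat_adjoint (krylov_mat L S y) *\<^sub>v x"
proof (rule eq_vecI)
  note K = krylov_mat_carrier[OF S, of L y]
  show "dim_vec (crosscorr_vec L S x y) = dim_vec (mat_adjoint (krylov_mat L S y) *\<^sub>v x)"
    using mat_adjoint_carrier[OF K] by (simp add: crosscorr_vec_def)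
  fix i assume "i < dim_vec (mat_adjoint (krylov_mat L S y) *\<^sub>v x)"
  then have "i < L" using mat_adjoint_carrier[OF K] by simp
  then show "crosscorr_vec L S x y $ i = (mat_adjoint (krylov_mat L S y) *\<^sub>v x) $ i"
    using mat_adjoint_carrier[OF K] K S
    by (simp add: crosscorr_vec_def graph_crosscorr_def row_mat_adjoint col_krylov_mat[OF S]
        conjugate_scalar_prod_adjoint[OF pow_carrier_mat[OF S] y x])
qed

text \<open>The autocorrelations are the inner products of the shifted signals, so their matrix is
  the Gram matrix of the columns of U.\<close>

lemma autocorr_mat_eq_krylov_mat:
  assumes S: "S \<in> carrier_mat N N" and y: "y \<in> carrier_vec N"
  shows "autocorr_mat L S y = mat_adjoint (krylov_mat L S y) * krylov_mat L S y"
proof (rule eq_matI)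
  note K = krylov_mat_carrier[OF S, of L y] and Ka = mat_adjoint_carrier[OF K]
  show "dim_row (autocorr_mat L S y) = dim_row (mat_adjoint (krylov_mat L S y) * krylov_mat L S y)"
    and "dim_col (autocorr_mat L S y) = dim_col (mat_adjoint (krylov_mat L S y) * krylov_mat L S y)"
    using K Ka by (simp_all add: autocorr_mat_def)
  fix i j assume "i < dim_row (mat_adjoint (krylov_mat L S y) * krylov_mat L S y)"
    and "j < dim_col (mat_adjoint (krylov_mat L S y) * krylov_mat L S y)"
  then have "i < L" "j < L" using K Ka by simp_all
  moreover have "S ^\<^sub>m j *\<^sub>v y \<in> carrier_vec N" using S pow_carrier_mat[OF S, of j] by (intro carrier_vecI) simp
  ultimately show "autocorr_mat L S y $$ (i, j)
      = (mat_adjoint (krylov_mat L S y) * krylov_mat L S y) $$ (i, j)"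
    using K Ka
    by (simp add: autocorr_mat_def graph_autocorr_def row_mat_adjoint col_krylov_mat[OF S]
        conjugate_scalar_prod_adjoint[OF pow_carrier_mat[OF S] y])
qed

lemma filtering_solution_iff_wiener_hopf:
  assumes S: "S \<in> carrier_mat N N" and x: "x \<in> carrier_vec N" and y: "y \<in> carrier_vec N"
    and h: "h \<in> carrier_vec L"
  shows "filtering_solution L S x y h \<longleftrightarrow> autocorr_mat L S y *\<^sub>v h = crosscorr_vec L S x y"
proof -
  note K = krylov_mat_carrier[OF S, of L y]
  have "filtering_solution L S x y h \<longleftrightarrow>
      is_arg_min (\<lambda>g. (norm2_vec (krylov_mat L S y *\<^sub>v g - x))\<^sup>2) (\<lambda>g. g \<in> carrier_vec L) h"
    \<comment> \<open>The two objectives are identified only on vectors of dimension L, so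
      minimality is unfolded to comparisons between feasible vectors before rewriting.\<close>
    by (auto simp: filtering_solution_def is_arg_min_linorder graph_filter_eq_krylov_mat[OF S])
  then show ?thesis
    using least_squares_iff_normal_equation[OF K x h]
      assoc_mult_mat_vec[OF mat_adjoint_carrier[OF K] K h]
    by (simp add: autocorr_mat_eq_krylov_mat[OF S y] crosscorr_vec_eq_krylov_mat[OF S x y])
qed

theorem mainTheorem6:
  fixes A :: "real mat" and V W \<Lambda> S :: "complex mat" and \<phi> :: "nat \<Rightarrow> real"
    and x y h :: "complex vec" and N L :: nat
  assumes "A \<in> carrier_mat N N"
    and "similar_mat_wit (map_mat complex_of_real A) \<Lambda> V W"
    and "diagonal_mat \<Lambda>"
    and "\<And>k. k < N \<Longrightarrow> \<phi> k \<in> {0..2 * pi}"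
    and "inj_on \<phi> {..<N}"
    and "S = graph_shift N V W \<phi>"
    and "x \<in> carrier_vec N" and "y \<in> carrier_vec N"
    and "1 \<le> L" and "L \<le> N"
    and "h \<in> carrier_vec L"
  shows "filtering_solution L S x y h \<longleftrightarrow> autocorr_mat L S y *\<^sub>v h = crosscorr_vec L S x y"
proof -
  \<comment> \<open>The similarity witness forces \<open>V\<close> and \<open>W\<close> to have the
    size of \<open>A\<close>, which makes the shift an N by N matrix.\<close>
  have "V \<in> carrier_mat N N" "W \<in> carrier_mat N N"
    using assms(1,2) by (auto simp: similar_mat_wit_def Let_def)
  then have "S \<in> carrier_mat N N" by (auto simp: assms(6) graph_shift_def)
  then show ?thesis
    using assms(7,8,11) by (rule filtering_solution_iff_wiener_hopf)
qed

end
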